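(* Let $G$ be a commutative semigroup with a finite system of generators $S$. Then the set of ergodic central measures on the space of infinite paths of the Cayley graph of $(G,S)$ (that is, the absolute $\mathscr{A}_S(G)$) coincides with the set of central measures that give rise to Markov chains with independent identically distributed increments. Thus the absolute is in bijective correspondence with the set of probability measures $\mu$ on $S$ for which the Markov chain with independent identically distributed increments of law $\mu$ is a central measure (the bijection sends such a $\mu$ to the measure with i.i.d. increments of law $\mu$).
   Context: A finite system of generators $S$ of a commutative semigroup $G$ (written additively) is a finite nonempty family of elements of $G$, repetitions allowed (repeated elements being treated as distinct members of $S$), generating $G$ (if $G$ has an identity element, the identity need not be a sum of a nonempty sequence of members of $S$). Let $G^1=G$ if $G$ has an identity element, and otherwise let $G^1$ be $G$ with an identity element adjoined; denote the identity by $0$. The Cayley graph of $(G,S)$ has vertex set $G^1$ and, for every vertex $g$ and every $s\in S$, a directed edge marked by $s$ from $g$ to $g+s$; the distinguished vertex is $0$. The space $\mathscr{P}$ of infinite paths starting at $0$ is compact in its natural (weak) topology; a path is determined by its sequence of edge marks, so $\mathscr{P}$ is identified with $S^{\mathbb{N}}$ with the product topology. All measures are Borel probability measures on $\mathscr{P}$. The measure of a finite path $R$ starting at $0$ is the measure of the cylinder of all infinite paths beginning with $R$. A measure $\nu$ on $\mathscr{P}$ is central if for every vertex $v$ and every positive integer $n$, $\nu$ takes the same value on all paths of length $n$ leading from $0$ to $v$. The set of central measures is a convex compact set; a central measure is ergodic if it is an extreme point of this set. The absolute $\mathscr{A}_S(G)$ is the set of all ergodic central measures. A measure $\nu$ on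 $\mathscr{P}$ gives rise to a Markov chain with independent identically distributed (i.i.d.) increments if its transition probabilities (at all vertices and all times) along all edges marked by the same generator are equal; that is, if there is a probability distribution $\mu$ on $S$ such that $\nu$ of every finite path with successive edge marks $s_1,\dots,s_n$ equals $\mu(s_1)\cdots\mu(s_n)$. *)

theory Defs
  imports "HOL-Probability.Probability"
begin

text \<open>
  A commutative semigroup is a type of class \<^class>\<open>ab_semigroup_add\<close>; a finite nonempty family of
  generators, repetitions allowed, is a function on a type of class \<^class>\<open>finite\<close>.
\<close>

definition is_identity :: "'a::ab_semigroup_add \<Rightarrow> bool"
  where "is_identity e \<longleftrightarrow> (\<forall>g. e + g = g)"

inductive_set generated :: "('s \<Rightarrow> 'a::ab_semigroup_add) \<Rightarrow> 'a set"
  for gen :: "'s \<Rightarrow> 'a"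
  where
    single: "gen s \<in> generated gen"
  | add: "g \<in> generated gen \<Longrightarrow> g + gen s \<in> generated gen"

text \<open>An identity element, if there is one, need not be a nonempty sum of generators.\<close>

definition generates :: "('s \<Rightarrow> 'a::ab_semigroup_add) \<Rightarrow> bool"
  where "generates gen \<longleftrightarrow> (\<forall>g. \<not> is_identity g \<longrightarrow> g \<in> generated gen)"

text \<open>
  The elements of \<open>G\<^sup>1\<close> are represented in \<^typ>\<open>'a option\<close>; \<^const>\<open>None\<close> is the adjoined identity
  and is a vertex only if the semigroup has no identity of its own.
\<close>

definition vertices :: "'a::ab_semigroup_add option set"
  where "vertices = (if \<exists>e::'a. is_identity e then range Some else UNIV)"

definition origin :: "'a::ab_semigroup_add option"
  where "origin = (if \<exists>e::'a. is_identity e then Some (THE e. is_identity e) else None)"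

text \<open>The head of the edge that is marked by \<open>s\<close> and starts at a given vertex.\<close>

fun edge_head :: "('s \<Rightarrow> 'a::ab_semigroup_add) \<Rightarrow> 'a option \<Rightarrow> 's \<Rightarrow> 'a option"
  where
    "edge_head gen None s = Some (gen s)"
  | "edge_head gen (Some g) s = Some (g + gen s)"

text \<open>Paths from the origin, finite or infinite, are given by their sequences of edge marks.\<close>

definition endpoint :: "('s \<Rightarrow> 'a::ab_semigroup_add) \<Rightarrow> 's list \<Rightarrow> 'a option"
  where "endpoint gen xs = foldl (edge_head gen) origin xs"

definition cylinder :: "'s list \<Rightarrow> (nat \<Rightarrow> 's) set"
  where "cylinder xs = {\<omega>. \<forall>i<length xs. \<omega> i = xs ! i}"

definition path_topology :: "(nat \<Rightarrow> 's) topology"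
  where "path_topology = product_topology (\<lambda>_. discrete_topology UNIV) UNIV"

definition path_borel :: "(nat \<Rightarrow> 's) measure"
  where "path_borel = sigma UNIV {U. openin path_topology U}"

definition path_measure :: "(nat \<Rightarrow> 's) measure \<Rightarrow> bool"
  where "path_measure \<nu> \<longleftrightarrow> prob_space \<nu> \<and> sets \<nu> = sets path_borel"

definition central :: "('s \<Rightarrow> 'a::ab_semigroup_add) \<Rightarrow> (nat \<Rightarrow> 's) measure \<Rightarrow> bool"
  where "central gen \<nu> \<longleftrightarrow> path_measure \<nu> \<and>
    (\<forall>v\<in>vertices. \<forall>n>0. \<forall>xs ys.
      length xs = n \<and> endpoint gen xs = v \<and> length ys = n \<and> endpoint gen ys = v \<longrightarrow>
      measure \<nu> (cylinder xs) = measure \<nu> (cylinder ys))"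

text \<open>
  The set of measures is not a real vector space in the library, so that \<^const>\<open>extreme_point_of\<close>
  does not apply; the second conjunct is its definition, for convex combinations of measures.
\<close>

definition ergodic_central :: "('s \<Rightarrow> 'a::ab_semigroup_add) \<Rightarrow> (nat \<Rightarrow> 's) measure \<Rightarrow> bool"
  where "ergodic_central gen \<nu> \<longleftrightarrow> central gen \<nu> \<and>
    (\<forall>\<nu>1 \<nu>2. \<forall>t::real. central gen \<nu>1 \<and> central gen \<nu>2 \<and> 0 < t \<and> t < 1 \<and>
      (\<forall>A\<in>sets path_borel. measure \<nu> A = (1 - t) * measure \<nu>1 A + t * measure \<nu>2 A) \<longrightarrow>
      \<nu>1 = \<nu>2)"

definition absolute :: "('s \<Rightarrow> 'a::ab_semigroup_add) \<Rightarrow> (nat \<Rightarrow> 's) measure set"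
  where "absolute gen = {\<nu>. ergodic_central gen \<nu>}"

definition iid_increments_law :: "'s pmf \<Rightarrow> (nat \<Rightarrow> 's) measure \<Rightarrow> bool"
  where "iid_increments_law \<mu> \<nu> \<longleftrightarrow> (\<forall>xs. measure \<nu> (cylinder xs) = (\<Prod>s\<leftarrow>xs. pmf \<mu> s))"

definition iid_increments :: "(nat \<Rightarrow> 's) measure \<Rightarrow> bool"
  where "iid_increments \<nu> \<longleftrightarrow> (\<exists>\<mu>. iid_increments_law \<mu> \<nu>)"

definition iid_measure :: "'s pmf \<Rightarrow> (nat \<Rightarrow> 's) measure"
  where "iid_measure \<mu> = (\<Pi>\<^sub>M i\<in>UNIV. measure_pmf \<mu>)"

lemma cylinder_measurable_PiM:
  "cylinder xs \<in> sets (\<Pi>\<^sub>M i\<in>UNIV. count_space (UNIV::'s set))"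
proof -
  have "cylinder xs = {\<omega> \<in> space (\<Pi>\<^sub>M i\<in>UNIV. count_space (UNIV::'s set)). \<forall>i<length xs. \<omega> i = xs ! i}"
    by (auto simp: cylinder_def space_PiM)
  also have "\<dots> \<in> sets (\<Pi>\<^sub>M i\<in>UNIV. count_space (UNIV::'s set))"
    by measurable
  finally show ?thesis .
qed

lemma space_path_borel [simp]: "space path_borel = UNIV"
  by (simp add: path_borel_def)

lemma sets_path_borel:
  "sets (path_borel :: (nat \<Rightarrow> 's::finite) measure) = sets (\<Pi>\<^sub>M i\<in>UNIV. count_space UNIV)"
proof (rule antisym)
  let ?P = "\<Pi>\<^sub>M i\<in>(UNIV::nat set). count_space (UNIV::'s set)"
  have "U \<in> sets ?P" if U: "openin path_topology U" for U :: "(nat \<Rightarrow> 's) set"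
  proof -
    have "\<exists>xs. \<omega> \<in> cylinder xs \<and> cylinder xs \<subseteq> U" if \<omega>U: "\<omega> \<in> U" for \<omega>
    proof -
      obtain V where fin: "finite {i. V i \<noteq> UNIV}" and \<omega>: "\<omega> \<in> PiE UNIV V" and V: "PiE UNIV V \<subseteq> U"
        using bspec [OF U [unfolded path_topology_def openin_product_topology_alt] \<omega>U]
        unfolding topspace_discrete_topology by auto
      obtain n where n: "\<And>i. V i \<noteq> UNIV \<Longrightarrow> i < n"
        using finite_nat_bounded [OF fin] by blast
      have "cylinder (map \<omega> [0..<n]) \<subseteq> PiE UNIV V"
      proof
        fix \<omega>' assume "\<omega>' \<in> cylinder (map \<omega> [0..<n])"
        then have eq: "\<omega>' i = \<omega> i" if "i < n" for i
          using that by (auto simp: cylinder_def)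
        show "\<omega>' \<in> PiE UNIV V"
          unfolding PiE_iff
        proof (intro conjI ballI)
          fix i
          have "\<omega> i \<in> V i"
            using \<omega> by blast
          then show "\<omega>' i \<in> V i"
            using n [of i] eq [of i] by (cases "V i = UNIV") auto
        qed simp
      qed
      moreover have "\<omega> \<in> cylinder (map \<omega> [0..<n])"
        by (auto simp: cylinder_def)
      ultimately show ?thesis
        using V by blast
    qed
    then have "U = (\<Union>xs\<in>{xs. cylinder xs \<subseteq> U}. cylinder xs)"
      by blast
    also have "\<dots> \<in> sets ?P"
      by (intro sets.countable_UN' countableI_type) (auto intro: cylinder_measurable_PiM)
    finally show ?thesis .
  qed
  then have "sigma_sets (space ?P) {U. openin path_topology U} \<subseteq> sets ?P"
    by (intro sets.sigma_sets_subset) blast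
  then show "sets path_borel \<subseteq> sets ?P"
    by (simp add: path_borel_def space_PiM)
  have "{f \<in> UNIV \<rightarrow>\<^sub>E UNIV. f i \<in> A} \<in> sets path_borel" for i :: nat and A :: "'s set"
  proof -
    have "openin path_topology {f \<in> topspace path_topology. f i \<in> A}"
      unfolding path_topology_def
      by (rule openin_continuous_map_preimage [OF continuous_map_product_projection]) simp_all
    then show ?thesis
      by (simp add: path_borel_def path_topology_def sigma_sets.Basic)
  qed
  then have "{{f \<in> UNIV \<rightarrow>\<^sub>E UNIV. f i \<in> A} |i A. i \<in> (UNIV :: nat set) \<and> A \<in> sets (count_space (UNIV :: 's set))}
      \<subseteq> sets path_borel" (is "?E \<subseteq> _")
    by blast
  then have "sigma_sets (space path_borel) ?E \<subseteq> sets path_borel"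
    by (rule sets.sigma_sets_subset)
  then show "sets ?P \<subseteq> sets path_borel"
    unfolding sets_PiM_single space_count_space space_path_borel PiE_UNIV .
qed

lemma path_measure_iid_measure: "path_measure (iid_measure \<mu> :: (nat \<Rightarrow> 's::finite) measure)"
proof -
  have "sets (iid_measure \<mu>) = sets (path_borel :: (nat \<Rightarrow> 's) measure)"
    unfolding sets_path_borel iid_measure_def by (intro sets_PiM_cong) simp_all
  moreover have "prob_space (iid_measure \<mu>)"
    unfolding iid_measure_def by (intro prob_space_PiM prob_space_measure_pmf)
  ultimately show ?thesis
    unfolding path_measure_def by blast
qed

lemma iid_increments_law_iid_measure: "iid_increments_law \<mu> (iid_measure \<mu>)"
  unfolding iid_increments_law_def
proof
  fix xs :: "'a list"
  interpret product_prob_space "\<lambda>_. measure_pmf \<mu>" "UNIV :: nat set"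
    by unfold_locales
  have eq: "cylinder xs = prod_emb UNIV (\<lambda>_. measure_pmf \<mu>) {..<length xs} (\<Pi>\<^sub>E i\<in>{..<length xs}. {xs ! i})"
    unfolding cylinder_def prod_emb_def
    by (rule set_eqI) (simp add: PiE_UNIV_domain PiE_iff Ball_def)
  have "measure (iid_measure \<mu>) (cylinder xs) = (\<Prod>i<length xs. measure (measure_pmf \<mu>) {xs ! i})"
    unfolding iid_measure_def eq by (rule measure_PiM_emb) simp_all
  also have "\<dots> = (\<Prod>s\<leftarrow>xs. pmf \<mu> s)"
    by (simp add: prod.list_conv_set_nth atLeast0LessThan pmf.rep_eq)
  finally show "measure (iid_measure \<mu>) (cylinder xs) = (\<Prod>s\<leftarrow>xs. pmf \<mu> s)" .
qed

end

theory Submission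
  imports Defs
begin

text \<open>
  By commutativity the endpoint of a path does not depend on the order of its edge marks, so a
  central measure \<open>\<nu>\<close> is shift invariant, and the law of the tail of the path conditioned on its
  first edge mark is again central. Hence \<open>\<nu>\<close> is the mixture of the tail laws given that the first
  mark is \<open>s\<close> and given that it is not; if \<open>\<nu>\<close> is ergodic, both equal \<open>\<nu>\<close>, which says that the
  first mark is independent of the tail and the tail has law \<open>\<nu>\<close>, so the increments are i.i.d.
  Conversely, a central component \<open>\<nu>'\<close> of an i.i.d. measure \<open>\<nu>\<close> satisfies \<open>\<nu>' \<le> C \<nu>\<close> and is shift
  invariant. The law of large numbers in mean square for \<open>\<nu>\<close> then carries over to \<open>\<nu>'\<close> and forces
  the two measures to agree on cylinders.
\<close>

section \<open>Endpoints of paths and centrality\<close>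

text \<open>Commutativity of the semigroup enters here: both sides add the same generators to
  \<open>v\<close>, in a different order.\<close>

lemma foldl_edge_head_commute:
  "foldl (edge_head gen) (edge_head gen v s) xs = edge_head gen (foldl (edge_head gen) v xs) s"
proof (induction xs arbitrary: v)
  case (Cons t xs)
  have "edge_head gen (edge_head gen v s) t = edge_head gen (edge_head gen v t) s"
    by (cases v) (simp_all add: ac_simps)
  then show ?case
    using Cons by simp
qed simp

lemma endpoint_Cons: "endpoint gen (s # xs) = edge_head gen (endpoint gen xs) s"
  by (simp add: endpoint_def foldl_edge_head_commute)

lemma endpoint_snoc: "endpoint gen (xs @ [s]) = endpoint gen (s # xs)"
  by (simp add: endpoint_Cons) (simp add: endpoint_def)

text \<open>Discharges the restriction to \<open>vertices\<close> in \<open>central\<close>, so that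
  centrality can be applied to words with equal endpoints.\<close>

lemma endpoint_in_vertices: "endpoint gen xs \<in> vertices"
proof (induction xs)
  case Nil
  then show ?case
    by (simp add: endpoint_def origin_def vertices_def)
next
  case (Cons s xs)
  then show ?case
    by (cases "endpoint gen xs") (auto simp: endpoint_Cons vertices_def split: if_splits)
qed

lemma central_eqD:
  assumes "central gen \<nu>" "length xs = length ys" "endpoint gen xs = endpoint gen ys"
  shows "measure \<nu> (cylinder xs) = measure \<nu> (cylinder ys)"
proof (cases "xs = []")
  \<comment> \<open>\<open>central\<close> speaks of positive lengths only; here both words are
    empty.\<close>
  case True
  then show ?thesis
    using assms by simp
next
  case False
  then show ?thesis
    using assms endpoint_in_vertices [of gen ys] unfolding central_def by (metis length_greater_0_conv)
qed

lemma path_measure_central: "central gen \<nu> \<Longrightarrow> path_measure \<nu>"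
  by (simp add: central_def)

section \<open>Cylinders, the one-sided shift and the Borel sets\<close>

definition path_drop :: "nat \<Rightarrow> (nat \<Rightarrow> 's) \<Rightarrow> nat \<Rightarrow> 's"
  where "path_drop n \<omega> = (\<lambda>i. \<omega> (i + n))"

lemma cylinder_Nil [simp]: "cylinder [] = UNIV"
  by (simp add: cylinder_def)

lemma cylinder_Cons: "cylinder (s # xs) = {\<omega>. \<omega> 0 = s} \<inter> path_drop 1 -` cylinder xs"
  by (auto simp: cylinder_def path_drop_def nth_Cons less_Suc_eq_0_disj split: nat.splits)

lemma cylinder_append: "cylinder (xs @ ys) = cylinder xs \<inter> path_drop (length xs) -` cylinder ys"
proof (induction xs)
  case Nil
  then show ?case
    by (simp add: path_drop_def vimage_def)
next
  case (Cons s xs)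
  then show ?case
    by (simp add: cylinder_Cons vimage_def path_drop_def Int_assoc) auto
qed

lemma UN_cylinder_snoc: "cylinder xs = (\<Union>s. cylinder (xs @ [s]))"
  by (auto simp: cylinder_append) (auto simp: cylinder_def path_drop_def)

text \<open>Two cylinders are disjoint or nested, the longer word giving the smaller one. The empty
  set is added for the disjoint case.\<close>

lemma Int_stable_cylinder: "Int_stable (insert {} (range cylinder))"
proof (rule Int_stableI)
  fix A B :: "(nat \<Rightarrow> 's) set"
  have le: "cylinder xs \<inter> cylinder ys \<in> insert {} (range cylinder)"
    if "length xs \<le> length ys" for xs ys :: "'s list"
  proof (cases "cylinder xs \<inter> cylinder ys = {}")
    case False
    with that have "cylinder xs \<inter> cylinder ys = cylinder ys"
      by (auto simp: cylinder_def)
    then show ?thesis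
      by auto
  qed simp
  have "cylinder xs \<inter> cylinder ys \<in> insert {} (range cylinder)" for xs ys :: "'s list"
    using le [of xs ys] le [of ys xs] by (cases "length xs \<le> length ys") (simp_all add: Int_commute)
  moreover assume "A \<in> insert {} (range cylinder)" "B \<in> insert {} (range cylinder)"
  ultimately show "A \<inter> B \<in> insert {} (range cylinder)"
    by blast
qed

lemma cylinder_sets [measurable]: "cylinder xs \<in> sets (path_borel :: (nat \<Rightarrow> 's::finite) measure)"
  unfolding sets_path_borel by (rule cylinder_measurable_PiM)

text \<open>Makes the cylinders a generator, as uniqueness of measures requires. An event on
  coordinate \<open>i\<close> is a union of cylinders of words of length \<open>i + 1\<close>, of
  which there are countably many.\<close>

lemma sets_path_borel_cylinder:
  "sets (path_borel :: (nat \<Rightarrow> 's::finite) measure) = sigma_sets UNIV (insert {} (range cylinder))"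
proof (rule antisym)
  interpret S: sigma_algebra UNIV "sigma_sets UNIV (insert {} (range cylinder :: (nat \<Rightarrow> 's) set set))"
    by (rule sigma_algebra_sigma_sets) auto
  have "{f \<in> UNIV \<rightarrow>\<^sub>E UNIV. f i \<in> A} \<in> sigma_sets UNIV (insert {} (range cylinder))" (is "?L \<in> _")
    for i :: nat and A :: "'s set"
  proof -
    have "?L = (\<Union>xs\<in>{xs. length xs = Suc i \<and> xs ! i \<in> A}. cylinder xs)"
    proof (intro set_eqI iffI)
      fix \<omega> assume "\<omega> \<in> ?L"
      then show "\<omega> \<in> (\<Union>xs\<in>{xs. length xs = Suc i \<and> xs ! i \<in> A}. cylinder xs)"
        by (intro UN_I [of "map \<omega> [0..<Suc i]"]) (auto simp: cylinder_def simp del: upt_Suc)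
    qed (auto simp: cylinder_def)
    also have "\<dots> \<in> sigma_sets UNIV (insert {} (range cylinder))"
      by (intro S.countable_UN'' countableI_type) auto
    finally show ?thesis .
  qed
  then show "sets path_borel \<subseteq> sigma_sets UNIV (insert {} (range cylinder :: (nat \<Rightarrow> 's) set set))"
    unfolding sets_path_borel sets_PiM_single space_count_space PiE_UNIV
    by (intro S.sigma_sets_subset) auto
  show "sigma_sets UNIV (insert {} (range cylinder)) \<subseteq> sets (path_borel :: (nat \<Rightarrow> 's) measure)"
    using sets.sigma_sets_subset [of "insert {} (range cylinder)" "path_borel :: (nat \<Rightarrow> 's) measure"]
    by (simp add: cylinder_sets image_subset_iff)
qed

lemma path_measureD:
  assumes "path_measure \<nu>"
  shows "prob_space \<nu>" "sets \<nu> = sets path_borel" "space \<nu> = UNIV"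
  using assms sets_eq_imp_space_eq [of \<nu> path_borel] by (auto simp: path_measure_def)

lemma path_measure_eqI:
  fixes M N :: "(nat \<Rightarrow> 's::finite) measure"
  assumes M: "path_measure M" and N: "path_measure N"
    and eq: "\<And>xs. measure M (cylinder xs) = measure N (cylinder xs)"
  shows "M = N"
proof -
  interpret M: prob_space M by (rule path_measureD [OF M])
  interpret N: prob_space N by (rule path_measureD [OF N])
  show ?thesis
  proof (rule measure_eqI_generator_eq [where \<Omega> = UNIV and E = "insert {} (range cylinder)" and A = "\<lambda>_. UNIV"])
    show "emeasure M X = emeasure N X" if "X \<in> insert {} (range cylinder)" for X
      using that eq by (auto simp: M.emeasure_eq_measure N.emeasure_eq_measure)
    show "range (\<lambda>_. UNIV) \<subseteq> insert {} (range (cylinder :: 's list \<Rightarrow> _))"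
      using cylinder_Nil by (metis image_subset_iff insert_iff rangeI)
  qed (auto simp: Int_stable_cylinder path_measureD [OF M] path_measureD [OF N] sets_path_borel_cylinder)
qed

lemma path_drop_measurable [measurable]:
  "path_drop n \<in> measurable path_borel (path_borel :: (nat \<Rightarrow> 's::finite) measure)"
proof -
  have "path_drop n \<in> measurable (\<Pi>\<^sub>M i\<in>UNIV. count_space (UNIV::'s set)) (\<Pi>\<^sub>M i\<in>UNIV. count_space UNIV)"
    unfolding path_drop_def by (rule measurable_PiM_single') (auto simp: space_PiM)
  then show ?thesis
    by (simp add: measurable_cong_sets [OF sets_path_borel sets_path_borel])
qed

lemma path_drop_vimage_sets:
  assumes "A \<in> sets (path_borel :: (nat \<Rightarrow> 's::finite) measure)"
  shows "path_drop n -` A \<in> sets path_borel"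
  using measurable_sets [OF path_drop_measurable [of n] assms] by simp

lemma head_sets [measurable]: "{\<omega>. \<omega> 0 \<in> B} \<in> sets (path_borel :: (nat \<Rightarrow> 's::finite) measure)"
proof -
  have "{\<omega>. \<omega> 0 \<in> B} = (\<Union>s\<in>B. cylinder [s])"
    by (auto simp: cylinder_def)
  then show ?thesis
    by auto
qed

lemma measure_cylinder_snoc:
  fixes \<nu> :: "(nat \<Rightarrow> 's::finite) measure"
  assumes "path_measure \<nu>"
  shows "measure \<nu> (cylinder xs) = (\<Sum>s\<in>UNIV. measure \<nu> (cylinder (xs @ [s])))"
proof -
  interpret prob_space \<nu> by (rule path_measureD [OF assms])
  show ?thesis
    by (subst UN_cylinder_snoc, rule finite_measure_finite_Union)
      (auto simp: path_measureD [OF assms] disjoint_family_on_def cylinder_append,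
       auto simp: cylinder_def)
qed

lemma measure_head_drop_cylinder:
  fixes \<nu> :: "(nat \<Rightarrow> 's::finite) measure"
  assumes "path_measure \<nu>"
  shows "measure \<nu> ({\<omega>. \<omega> 0 \<in> B} \<inter> path_drop 1 -` cylinder xs) = (\<Sum>s\<in>B. measure \<nu> (cylinder (s # xs)))"
proof -
  interpret prob_space \<nu> by (rule path_measureD [OF assms])
  have *: "{\<omega>. \<omega> 0 \<in> B} \<inter> path_drop 1 -` cylinder xs = (\<Union>s\<in>B. cylinder (s # xs))"
    by (auto simp: cylinder_Cons)
  show ?thesis
    unfolding *
  proof (rule finite_measure_finite_Union)
    show "disjoint_family_on (\<lambda>s. cylinder (s # xs)) B"
      by (auto simp: disjoint_family_on_def cylinder_Cons)
  qed (auto simp: path_measureD [OF assms])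
qed

section \<open>Conditioning on the first mark; shift invariance\<close>

text \<open>Conditional law of the shifted path given that the first mark lies in \<open>B\<close>.
  A set is allowed because several choices are used: \<open>{s}\<close> and its complement split an
  ergodic measure, and \<open>UNIV\<close> yields the law of the shifted path.\<close>

definition tail_given_head :: "(nat \<Rightarrow> 's) measure \<Rightarrow> 's set \<Rightarrow> (nat \<Rightarrow> 's) measure"
  where "tail_given_head \<nu> B = distr (uniform_measure \<nu> {\<omega>. \<omega> 0 \<in> B}) path_borel (path_drop 1)"

lemma
  fixes \<nu> :: "(nat \<Rightarrow> 's::finite) measure"
  assumes \<nu>: "path_measure \<nu>" and pos: "measure \<nu> {\<omega>. \<omega> 0 \<in> B} > 0"
  shows path_measure_tail_given_head: "path_measure (tail_given_head \<nu> B)"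
    and measure_tail_given_head: "A \<in> sets path_borel \<Longrightarrow>
      measure (tail_given_head \<nu> B) A =
        measure \<nu> ({\<omega>. \<omega> 0 \<in> B} \<inter> path_drop 1 -` A) / measure \<nu> {\<omega>. \<omega> 0 \<in> B}"
proof -
  interpret prob_space \<nu> by (rule path_measureD [OF \<nu>])
  let ?E = "{\<omega>. \<omega> 0 \<in> B}"
  have E: "emeasure \<nu> ?E \<noteq> 0" "emeasure \<nu> ?E \<noteq> \<infinity>"
    using pos by (auto simp: emeasure_eq_measure)
  have "measurable (uniform_measure \<nu> ?E) path_borel = measurable path_borel path_borel"
    by (rule measurable_cong_sets) (simp_all add: path_measureD [OF \<nu>])
  then have drop: "path_drop 1 \<in> measurable (uniform_measure \<nu> ?E) path_borel"
    using path_drop_measurable by blast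
  show "path_measure (tail_given_head \<nu> B)"
    unfolding path_measure_def tail_given_head_def
    using prob_space.prob_space_distr [OF prob_space_uniform_measure [OF E] drop] by simp
  show "measure (tail_given_head \<nu> B) A = measure \<nu> (?E \<inter> path_drop 1 -` A) / measure \<nu> ?E"
    if "A \<in> sets path_borel"
    unfolding tail_given_head_def using E that
    by (simp add: measure_distr [OF drop] path_measureD [OF \<nu>] head_sets path_drop_vimage_sets
      del: One_nat_def)
qed

text \<open>Prefixing the same mark to two words of equal length and equal endpoint keeps both
  properties. Centrality of \<nu> thus equates the summands over \<open>B\<close>, and the
  normalising factor is common to both sides.\<close>

lemma central_tail_given_head:
  fixes gen :: "'s::finite \<Rightarrow> 'a::ab_semigroup_add"
  assumes \<nu>: "central gen \<nu>" and pos: "measure \<nu> {\<omega>. \<omega> 0 \<in> B} > 0"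
  shows "central gen (tail_given_head \<nu> B)"
proof -
  note \<nu>' = path_measure_central [OF \<nu>]
  have "measure (tail_given_head \<nu> B) (cylinder xs) = measure (tail_given_head \<nu> B) (cylinder ys)"
    if "length xs = length ys" "endpoint gen xs = endpoint gen ys" for xs ys
  proof -
    have "measure \<nu> (cylinder (s # xs)) = measure \<nu> (cylinder (s # ys))" for s
      by (rule central_eqD [OF \<nu>]) (simp_all add: that endpoint_Cons)
    then show ?thesis
      by (simp add: measure_tail_given_head [OF \<nu>' pos] measure_head_drop_cylinder [OF \<nu>', unfolded One_nat_def])
  qed
  then show ?thesis
    by (simp add: central_def path_measure_tail_given_head [OF \<nu>' pos])
qed

text \<open>
  Since \<open>G\<close> is commutative, centrality allows the unconstrained first step to be moved to the end of
  the path, where summing over it gives no constraint at all.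
\<close>

lemma central_shift_invariant:
  fixes gen :: "'s::finite \<Rightarrow> 'a::ab_semigroup_add"
  assumes \<nu>: "central gen \<nu>" and A: "A \<in> sets path_borel"
  shows "measure \<nu> (path_drop n -` A) = measure \<nu> A"
proof -
  note \<nu>' = path_measure_central [OF \<nu>]
  interpret prob_space \<nu> by (rule path_measureD [OF \<nu>'])
  have pos: "measure \<nu> {\<omega>. \<omega> 0 \<in> (UNIV :: 's set)} > 0"
    using prob_space by (simp add: path_measureD [OF \<nu>'])
  \<comment> \<open>Conditioning on the whole space is trivial, so this equation is shift invariance
    by one step.\<close>
  have "tail_given_head \<nu> UNIV = \<nu>"
  proof (rule path_measure_eqI)
    show "measure (tail_given_head \<nu> UNIV) (cylinder xs) = measure \<nu> (cylinder xs)" for xs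
    proof -
      have "measure (tail_given_head \<nu> UNIV) (cylinder xs) = (\<Sum>s\<in>UNIV. measure \<nu> (cylinder (s # xs)))"
        using prob_space measure_head_drop_cylinder [OF \<nu>', of UNIV xs]
        by (simp add: measure_tail_given_head [OF \<nu>' pos] path_measureD [OF \<nu>'])
      also have "\<dots> = (\<Sum>s\<in>UNIV. measure \<nu> (cylinder (xs @ [s])))"
        by (intro sum.cong refl central_eqD [OF \<nu>]) (simp_all add: endpoint_snoc)
      finally show ?thesis
        by (simp add: measure_cylinder_snoc [OF \<nu>', of xs])
    qed
  qed (simp_all add: path_measure_tail_given_head [OF \<nu>' pos] \<nu>')
  then have *: "measure \<nu> (path_drop 1 -` A) = measure \<nu> A" if "A \<in> sets path_borel" for A
    using measure_tail_given_head [OF \<nu>' pos that] prob_space by (simp add: path_measureD [OF \<nu>'])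
  show ?thesis
  proof (induction n)
    case 0
    then show ?case
      by (simp add: path_drop_def vimage_def)
  next
    case (Suc n)
    have "path_drop (Suc n) -` A = path_drop 1 -` (path_drop n -` A)"
      by (simp add: path_drop_def vimage_def)
    then show ?case
      using * [OF path_drop_vimage_sets [OF A]] Suc by simp
  qed
qed

section \<open>Ergodic central measures have i.i.d. increments\<close>

lemma ergodic_central_imp_iid:
  fixes gen :: "'s::finite \<Rightarrow> 'a::ab_semigroup_add"
  assumes "ergodic_central gen \<nu>"
  shows "iid_increments \<nu>"
proof -
  have \<nu>: "central gen \<nu>"
    using assms by (simp add: ergodic_central_def)
  note \<nu>' = path_measure_central [OF \<nu>]
  interpret prob_space \<nu> by (rule path_measureD [OF \<nu>'])
  define p where "p s = measure \<nu> (cylinder [s])" for s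
  have head: "{\<omega>. \<omega> 0 \<in> {s}} = cylinder [s]" for s :: 's
    by (auto simp: cylinder_def)
  have p1: "(\<Sum>s\<in>UNIV. p s) = 1"
    using measure_cylinder_snoc [OF \<nu>', of "[]"] prob_space by (simp add: p_def path_measureD [OF \<nu>'])
  \<comment> \<open>First mark and tail are independent, in cylinder form; iterating this gives the
    product formula.\<close>
  have step: "measure \<nu> (cylinder (s # xs)) = p s * measure \<nu> (cylinder xs)" for s xs
  proof -
    let ?B = "{\<omega>. \<omega> 0 \<in> {s}}" and ?C = "{\<omega>. \<omega> 0 \<in> - {s}}"
    have meas: "?B \<in> events" "?C \<in> events" "\<And>A. A \<in> sets path_borel \<Longrightarrow> path_drop 1 -` A \<in> events"
      unfolding path_measureD [OF \<nu>'] by (rule head_sets path_drop_vimage_sets | assumption)+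
    \<comment> \<open>By shift invariance \<nu> is the law of the tail, which is cut here according
      to the first mark.\<close>
    have split: "measure \<nu> A = measure \<nu> (?B \<inter> path_drop 1 -` A) + measure \<nu> (?C \<inter> path_drop 1 -` A)"
      if A: "A \<in> sets path_borel" for A
    proof -
      have "measure \<nu> A = measure \<nu> (path_drop 1 -` A)"
        by (rule central_shift_invariant [OF \<nu> A, symmetric])
      also have "path_drop 1 -` A = (?B \<inter> path_drop 1 -` A) \<union> (?C \<inter> path_drop 1 -` A)"
        by auto
      also have "measure \<nu> \<dots> = measure \<nu> (?B \<inter> path_drop 1 -` A) + measure \<nu> (?C \<inter> path_drop 1 -` A)"
        using meas A by (intro finite_measure_Union) auto
      finally show ?thesis .
    qed
    have p: "measure \<nu> ?B = p s"
      by (simp only: head p_def)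
    have "measure \<nu> UNIV = 1"
      using prob_space by (simp add: path_measureD [OF \<nu>'])
    then have q: "measure \<nu> ?C = 1 - p s"
      using split [of UNIV] sets.top [of "path_borel :: (nat \<Rightarrow> 's) measure"] p by simp
    have cyl: "cylinder (s # xs) = ?B \<inter> path_drop 1 -` cylinder xs" for xs
      by (simp add: cylinder_Cons)
    \<comment> \<open>Both conditional tail laws need their event to have positive probability, so
      the values 0 and 1 of \<open>p s\<close> are treated apart.\<close>
    consider "p s = 0" | "p s = 1" | "0 < p s" "p s < 1"
      using p q measure_nonneg [of \<nu> ?B] measure_nonneg [of \<nu> ?C] by fastforce
    then show ?thesis
    proof cases
      case 1
      have "measure \<nu> (cylinder (s # xs)) \<le> measure \<nu> ?B"
        unfolding cyl using meas by (intro finite_measure_mono) auto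
      then show ?thesis
        using 1 p by (simp add: measure_le_0_iff)
    next
      case 2
      have "measure \<nu> (?C \<inter> path_drop 1 -` cylinder xs) \<le> measure \<nu> ?C"
        using meas by (intro finite_measure_mono) auto
      then show ?thesis
        using 2 q split [OF cylinder_sets, of xs] by (simp add: cyl measure_le_0_iff)
    next
      case 3
      \<comment> \<open>A convex combination as in \<open>ergodic_central\<close>, with
        \<open>t = p s\<close>.\<close>
      have mix: "measure \<nu> A = (1 - p s) * measure (tail_given_head \<nu> (- {s})) A + p s * measure (tail_given_head \<nu> {s}) A"
        if "A \<in> sets path_borel" for A
        using 3 p q split [OF that] by (simp add: measure_tail_given_head [OF \<nu>'] that)
      have "central gen (tail_given_head \<nu> (- {s}))" "central gen (tail_given_head \<nu> {s})"
        by (rule central_tail_given_head [OF \<nu>]; use 3 p q in linarith)+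
      then have eq: "tail_given_head \<nu> (- {s}) = tail_given_head \<nu> {s}"
        using assms 3 mix unfolding ergodic_central_def by blast
      \<comment> \<open>With equal components the mixture collapses: conditioning on the first mark
        leaves the probability of a tail cylinder unchanged.\<close>
      have "measure \<nu> (cylinder xs) = measure (tail_given_head \<nu> {s}) (cylinder xs)"
        using mix [OF cylinder_sets, of xs] by (simp add: eq algebra_simps)
      then show ?thesis
        using 3 p measure_tail_given_head [OF \<nu>', of "{s}" "cylinder xs"] by (simp add: cyl)
    qed
  qed
  define \<mu> where "\<mu> = embed_pmf p"
  have pmf: "pmf \<mu> s = p s" for s
    unfolding \<mu>_def
  proof (rule pmf_embed_pmf)
    show nonneg: "0 \<le> p s" for s
      by (simp add: p_def)
    show "(\<integral>\<^sup>+s. ennreal (p s) \<partial>count_space UNIV) = 1"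
      by (simp add: nn_integral_count_space_finite sum_ennreal nonneg p1)
  qed
  have "measure \<nu> (cylinder xs) = (\<Prod>s\<leftarrow>xs. pmf \<mu> s)" for xs
    using prob_space by (induction xs) (simp_all add: step pmf path_measureD [OF \<nu>'])
  then show ?thesis
    unfolding iid_increments_def iid_increments_law_def by blast
qed

section \<open>Central i.i.d. measures are ergodic\<close>

text \<open>For one mark of positive weight, the conditional tail law has the cylinder values of
  \<nu> and so equals \<nu>; induction on the word does the rest. \<open>A\<close> is a general
  Borel set because the law of large numbers below applies this to shifted cylinders.\<close>

lemma iid_cylinder_drop:
  fixes \<nu> :: "(nat \<Rightarrow> 's::finite) measure"
  assumes \<nu>: "path_measure \<nu>" and iid: "iid_increments_law \<mu> \<nu>" and A: "A \<in> sets path_borel"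
  shows "measure \<nu> (cylinder xs \<inter> path_drop (length xs) -` A) = measure \<nu> (cylinder xs) * measure \<nu> A"
proof (induction xs)
  case Nil
  interpret prob_space \<nu> by (rule path_measureD [OF \<nu>])
  show ?case
    using prob_space by (simp add: path_drop_def vimage_def path_measureD [OF \<nu>])
next
  case (Cons s xs)
  interpret prob_space \<nu> by (rule path_measureD [OF \<nu>])
  let ?B = "{\<omega>. \<omega> 0 \<in> {s}}"
  have cyl: "measure \<nu> (cylinder (s # xs)) = pmf \<mu> s * measure \<nu> (cylinder xs)" for s xs
    using iid by (simp add: iid_increments_law_def)
  have B: "measure \<nu> ?B = pmf \<mu> s"
    using measure_head_drop_cylinder [OF \<nu>, of "{s}" "[]"] iid by (simp add: iid_increments_law_def)
  have head: "measure \<nu> (?B \<inter> path_drop 1 -` A) = pmf \<mu> s * measure \<nu> A" if A: "A \<in> sets path_borel" for A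
  proof (cases "pmf \<mu> s = 0")
    \<comment> \<open>There is no conditional law given a null mark, but both sides vanish.\<close>
    case True
    have "measure \<nu> (?B \<inter> path_drop 1 -` A) \<le> measure \<nu> ?B"
      by (rule finite_measure_mono) (simp_all only: path_measureD [OF \<nu>] head_sets Int_lower1)
    then show ?thesis
      using True B by (simp add: measure_le_0_iff)
  next
    case False
    then have pos: "measure \<nu> ?B > 0"
      using B by (simp add: pmf_positive_iff less_le)
    have "tail_given_head \<nu> {s} = \<nu>"
    proof (rule path_measure_eqI)
      show "measure (tail_given_head \<nu> {s}) (cylinder xs) = measure \<nu> (cylinder xs)" for xs
        using False B measure_tail_given_head [OF \<nu> pos, of "cylinder xs"]
          measure_head_drop_cylinder [OF \<nu>, of "{s}" xs] by (simp add: cyl)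
    qed (simp_all add: path_measure_tail_given_head [OF \<nu> pos] \<nu>)
    then show ?thesis
      using measure_tail_given_head [OF \<nu> pos A] B False by (simp add: field_simps)
  qed
  have "cylinder (s # xs) \<inter> path_drop (length (s # xs)) -` A
      = ?B \<inter> path_drop 1 -` (cylinder xs \<inter> path_drop (length xs) -` A)"
    by (auto simp: cylinder_Cons) (simp_all add: path_drop_def)
  also have "measure \<nu> \<dots> = pmf \<mu> s * measure \<nu> (cylinder xs \<inter> path_drop (length xs) -` A)"
    by (rule head) (use A in auto)
  finally show ?case
    by (simp add: Cons cyl)
qed

text \<open>
  The weak law of large numbers for the indicators of the blocks of length \<open>length xs\<close>: it holds in
  mean square for \<open>\<nu>\<close>, hence also for \<open>\<nu>'\<close>, whose mean of the average is \<open>measure \<nu>' (cylinder xs)\<close>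
  by shift invariance.
\<close>

lemma iid_dominates_imp_eq:
  fixes gen :: "'s::finite \<Rightarrow> 'a::ab_semigroup_add"
  assumes \<nu>: "central gen \<nu>" and iid: "iid_increments_law \<mu> \<nu>" and \<nu>': "central gen \<nu>'"
    and le: "\<And>A. A \<in> sets path_borel \<Longrightarrow> measure \<nu>' A \<le> C * measure \<nu> A"
  shows "\<nu>' = \<nu>"
proof (rule path_measure_eqI)
  note pm = path_measure_central [OF \<nu>] and pm' = path_measure_central [OF \<nu>']
  show "path_measure \<nu>" "path_measure \<nu>'"
    by (fact pm pm')+
  interpret M: prob_space \<nu> by (rule path_measureD [OF pm])
  interpret N: prob_space \<nu>' by (rule path_measureD [OF pm'])
  \<comment> \<open>Compares the total masses. The sign of \<open>C\<close> is needed to pass to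
    \<open>ennreal\<close> and to scale inequalities.\<close>
  have C: "C \<ge> 1"
    using le [of UNIV] M.prob_space N.prob_space path_measureD(3) [OF pm] path_measureD(3) [OF pm']
    by (metis mult.right_neutral sets.top space_path_borel)
  fix xs :: "'s list"
  define p where "p = measure \<nu> (cylinder xs)"
  \<comment> \<open>Different blocks read disjoint sets of coordinates, which makes these events
    pairwise independent under \<nu>.\<close>
  define A where "A i = path_drop (i * length xs) -` cylinder xs" for i
  have A: "A i \<in> sets path_borel" for i
    unfolding A_def by (intro path_drop_vimage_sets cylinder_sets)
  have AM: "A i \<in> M.events" and AN: "A i \<in> N.events" for i
    using A by (simp_all add: path_measureD [OF pm] path_measureD [OF pm'])
  have pA: "measure \<nu> (A i) = p" and pA': "measure \<nu>' (A i) = measure \<nu>' (cylinder xs)" for i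
    unfolding A_def p_def using central_shift_invariant [OF \<nu>] central_shift_invariant [OF \<nu>'] by simp_all
  have indep: "measure \<nu> (A i \<inter> A j) = p * p" if "i < j" for i j
  proof -
    obtain d where d: "j = i + 1 + d"
      using \<open>i < j\<close> less_imp_Suc_add by fastforce
    \<comment> \<open>After dropping \<open>i\<close> blocks, \<open>A i\<close> becomes the initial
      cylinder and \<open>A j\<close> becomes \<open>A d\<close> seen one block later, as
      \<open>j = i + 1 + d\<close>.\<close>
    have "A i \<inter> A j = path_drop (i * length xs) -` (cylinder xs \<inter> path_drop (length xs) -` A d)"
      by (auto simp: A_def d path_drop_def algebra_simps)
    then show ?thesis
      using central_shift_invariant [OF \<nu> sets.Int [OF cylinder_sets path_drop_vimage_sets [OF A]]]
        iid_cylinder_drop [OF pm iid A]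
      by (simp add: pA p_def)
  qed
  \<comment> \<open>Off the diagonal the covariance vanishes; on it the value is
    \<open>p - p * p\<close>. Hence only \<open>n\<close> of the \<open>n * n\<close> terms
    contribute to the second moment of the sum.\<close>
  have cov: "(\<integral>\<omega>. (indicator (A i) \<omega> - p) * (indicator (A j) \<omega> - p) \<partial>\<nu>) \<le> (if i = j then 1 else 0)" for i j
  proof -
    have "(\<integral>\<omega>. (indicator (A i) \<omega> - p) * (indicator (A j) \<omega> - p) \<partial>\<nu>)
      = (\<integral>\<omega>. indicator (A i \<inter> A j) \<omega> - p * indicator (A i) \<omega> - p * indicator (A j) \<omega> + p * p \<partial>\<nu>)"
      by (intro Bochner_Integration.integral_cong) (auto simp: indicator_def algebra_simps)
    also have "\<dots> = measure \<nu> (A i \<inter> A j) - p * p"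
      using AM [of i] AM [of j] sets.Int [OF AM [of i] AM [of j]] M.prob_space
      by (simp add: pA M.emeasure_eq_measure)
    also have "\<dots> \<le> (if i = j then 1 else 0)"
      using indep [of i j] indep [of j i] M.prob_le_1 [of "A i"]
      by (cases i j rule: linorder_cases) (auto simp: Int_commute pA intro: order_trans [of _ p])
    finally show ?thesis .
  qed
  \<comment> \<open>The centring uses the mean \<open>p\<close> under \<nu> also when integrating
    against \<open>\<nu>'\<close>, so that the mean under \<open>\<nu>'\<close> measures the
    difference of the two measures on the cylinder.\<close>
  define Y where "Y n \<omega> = (\<Sum>i<n. indicator (A i) \<omega> - p)" for n \<omega>
  have sq: "(Y n \<omega>)\<^sup>2 = (\<Sum>i<n. \<Sum>j<n. (indicator (A i) \<omega> - p) * (indicator (A j) \<omega> - p))" for n \<omega>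
    by (simp add: Y_def power2_eq_square sum_product)
  have "\<bar>indicator (A i) \<omega> - p\<bar> \<le> 1" for i \<omega>
    by (auto simp: indicator_def p_def)
  then have le_1: "\<bar>(indicator (A i) \<omega> - p) * (indicator (A j) \<omega> - p)\<bar> \<le> 1" for i j \<omega>
    by (simp add: abs_mult mult_le_one)
  have intM: "integrable \<nu> (\<lambda>\<omega>. (indicator (A i) \<omega> - p) * (indicator (A j) \<omega> - p))" for i j
    using AM le_1 by (intro M.integrable_const_bound [where B = 1]) simp_all
  have intN: "integrable \<nu>' (\<lambda>\<omega>. (indicator (A i) \<omega> - p) * (indicator (A j) \<omega> - p))" for i j
    using AN le_1 by (intro N.integrable_const_bound [where B = 1]) simp_all
  have sqM: "integrable \<nu> (\<lambda>\<omega>. (Y n \<omega>)\<^sup>2)" and sqN: "integrable \<nu>' (\<lambda>\<omega>. (Y n \<omega>)\<^sup>2)" for n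
    unfolding sq using intM intN by simp_all
  have YN: "integrable \<nu>' (Y n)" for n
    unfolding Y_def using AN
    by (intro Bochner_Integration.integrable_sum Bochner_Integration.integrable_diff)
      (simp_all add: N.emeasure_eq_measure)
  have varM: "(\<integral>\<omega>. (Y n \<omega>)\<^sup>2 \<partial>\<nu>) \<le> n" for n
  proof -
    have "(\<integral>\<omega>. (Y n \<omega>)\<^sup>2 \<partial>\<nu>) = (\<Sum>i<n. \<Sum>j<n. \<integral>\<omega>. (indicator (A i) \<omega> - p) * (indicator (A j) \<omega> - p) \<partial>\<nu>)"
      unfolding sq using intM by (simp add: Bochner_Integration.integral_sum)
    also have "\<dots> \<le> (\<Sum>i<n. \<Sum>j<n. if i = j then 1 else 0)"
      by (intro sum_mono cov)
    finally show ?thesis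
      by simp
  qed
  have mean: "(\<integral>\<omega>. Y n \<omega> \<partial>\<nu>') = n * (measure \<nu>' (cylinder xs) - p)" for n
  proof -
    have "integrable \<nu>' (\<lambda>\<omega>. indicator (A i) \<omega> - p)"
      and "(\<integral>\<omega>. indicator (A i) \<omega> - p \<partial>\<nu>') = measure \<nu>' (cylinder xs) - p" for i
      using AN [of i] N.prob_space by (simp_all add: N.emeasure_eq_measure pA')
    then show ?thesis
      by (simp add: Y_def [abs_def] Bochner_Integration.integral_sum)
  qed
  have dom: "(\<integral>\<omega>. (Y n \<omega>)\<^sup>2 \<partial>\<nu>') \<le> C * (\<integral>\<omega>. (Y n \<omega>)\<^sup>2 \<partial>\<nu>)" for n
  proof -
    \<comment> \<open>Domination on events becomes an inequality of measures, which carries over to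
      integrals of nonnegative functions.\<close>
    have "\<nu>' \<le> scale_measure (ennreal C) \<nu>"
      using le C by (subst le_measure)
        (auto simp: path_measureD [OF pm] path_measureD [OF pm'] M.emeasure_eq_measure
          N.emeasure_eq_measure ennreal_mult' [symmetric])
    then have "(\<integral>\<^sup>+\<omega>. ennreal ((Y n \<omega>)\<^sup>2) \<partial>\<nu>') \<le> (\<integral>\<^sup>+\<omega>. ennreal ((Y n \<omega>)\<^sup>2) \<partial>scale_measure (ennreal C) \<nu>)"
      by (intro nn_integral_mono_measure) (auto simp: path_measureD [OF pm] path_measureD [OF pm'])
    also have "\<dots> = ennreal C * (\<integral>\<^sup>+\<omega>. ennreal ((Y n \<omega>)\<^sup>2) \<partial>\<nu>)"
      using sqM by (intro nn_integral_scale_measure) auto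
    finally show ?thesis
      using C by (simp add: nn_integral_eq_integral [OF sqM] nn_integral_eq_integral [OF sqN]
          ennreal_mult' [symmetric])
  qed
  have bound: "n * (measure \<nu>' (cylinder xs) - p)\<^sup>2 \<le> C" if "n > 0" for n :: nat
  proof -
    \<comment> \<open>Nonnegativity of the variance bounds the squared mean by the second moment.
      The former is quadratic in \<open>n\<close> and the latter at most \<open>C * n\<close>, so
      the squared deviation is at most \<open>C / n\<close>.\<close>
    have "(\<integral>\<omega>. Y n \<omega> \<partial>\<nu>')\<^sup>2 \<le> (\<integral>\<omega>. (Y n \<omega>)\<^sup>2 \<partial>\<nu>')"
      using N.variance_eq [OF YN sqN, of n] N.variance_positive [of "Y n"] by simp
    also have "\<dots> \<le> C * n"
      using C by (intro order_trans [OF dom] mult_left_mono varM) simp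
    finally have "n * (n * (measure \<nu>' (cylinder xs) - p)\<^sup>2) \<le> n * C"
      unfolding mean by (simp add: power2_eq_square algebra_simps)
    then show ?thesis
      using that by simp
  qed
  have "(measure \<nu>' (cylinder xs) - p)\<^sup>2 = 0"
  proof (rule ccontr)
    assume "(measure \<nu>' (cylinder xs) - p)\<^sup>2 \<noteq> 0"
    then have "(measure \<nu>' (cylinder xs) - p)\<^sup>2 > 0"
      by simp
    then obtain n :: nat where "C < n * (measure \<nu>' (cylinder xs) - p)\<^sup>2"
      using ex_less_of_nat_mult by blast
    then show False
      using bound [of n] C by (cases "n = 0") auto
  qed
  then show "measure \<nu>' (cylinder xs) = measure \<nu> (cylinder xs)"
    by (simp add: p_def)
qed

text \<open>In a convex decomposition each central component is dominated by a multiple of \<nu>,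
  with factors \<open>1 / (1 - t)\<close> and \<open>1 / t\<close>, and domination already forces it
  to equal \<nu>.\<close>

lemma iid_imp_ergodic_central:
  fixes gen :: "'s::finite \<Rightarrow> 'a::ab_semigroup_add"
  assumes \<nu>: "central gen \<nu>" and iid: "iid_increments_law \<mu> \<nu>"
  shows "ergodic_central gen \<nu>"
  unfolding ergodic_central_def
proof (intro conjI allI impI)
  fix \<nu>1 \<nu>2 and t :: real
  assume "central gen \<nu>1 \<and> central gen \<nu>2 \<and> 0 < t \<and> t < 1 \<and>
    (\<forall>A\<in>sets path_borel. measure \<nu> A = (1 - t) * measure \<nu>1 A + t * measure \<nu>2 A)"
  then have c: "central gen \<nu>1" "central gen \<nu>2" and t: "0 < t" "t < 1"
    and eq: "\<And>A. A \<in> sets path_borel \<Longrightarrow> measure \<nu> A = (1 - t) * measure \<nu>1 A + t * measure \<nu>2 A"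
    by auto
  have "(1 - t) * measure \<nu>1 A \<le> measure \<nu> A" "t * measure \<nu>2 A \<le> measure \<nu> A" if "A \<in> sets path_borel" for A
    using t eq [OF that] by simp_all
  then have le: "measure \<nu>1 A \<le> 1 / (1 - t) * measure \<nu> A" "measure \<nu>2 A \<le> 1 / t * measure \<nu> A"
    if "A \<in> sets path_borel" for A
    using t that by (simp_all add: field_simps)
  have "\<nu>1 = \<nu>"
    by (rule iid_dominates_imp_eq [OF \<nu> iid c(1) le(1)])
  moreover have "\<nu>2 = \<nu>"
    by (rule iid_dominates_imp_eq [OF \<nu> iid c(2) le(2)])
  ultimately show "\<nu>1 = \<nu>2"
    by simp
qed (fact \<nu>)

section \<open>The bijection with laws on the generators\<close>

lemma iid_increments_law_unique:
  fixes \<nu> :: "(nat \<Rightarrow> 's::finite) measure"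
  assumes "path_measure \<nu>" "iid_increments_law \<mu> \<nu>"
  shows "\<nu> = iid_measure \<mu>"
  using assms path_measure_iid_measure [of \<mu>] iid_increments_law_iid_measure [of \<mu>]
  by (intro path_measure_eqI) (simp_all add: iid_increments_law_def)

text \<open>The weights of the law are recovered as the measures of the cylinders of words of length
  one.\<close>

lemma inj_iid_measure: "inj (iid_measure :: 's::finite pmf \<Rightarrow> _)"
proof (rule injI)
  fix \<mu> \<mu>' :: "'s pmf"
  assume "iid_measure \<mu> = iid_measure \<mu>'"
  then have "(\<Prod>s\<leftarrow>xs. pmf \<mu> s) = (\<Prod>s\<leftarrow>xs. pmf \<mu>' s)" for xs
    using iid_increments_law_iid_measure [of \<mu>] iid_increments_law_iid_measure [of \<mu>']
    by (simp add: iid_increments_law_def)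
  from this [of "[_]"] show "\<mu> = \<mu>'"
    by (intro pmf_eqI) simp
qed

theorem theorem1:
  fixes gen :: "'s::finite \<Rightarrow> 'a::ab_semigroup_add"
  assumes "generates gen"
  shows "absolute gen = {\<nu>. central gen \<nu> \<and> iid_increments \<nu>} \<and>
    bij_betw iid_measure {\<mu>. central gen (iid_measure \<mu>)} (absolute gen)"
proof
  show abs: "absolute gen = {\<nu>. central gen \<nu> \<and> iid_increments \<nu>}"
    unfolding absolute_def
  proof (intro Collect_cong iffI conjI)
    fix \<nu> assume "ergodic_central gen \<nu>"
    then show "central gen \<nu>" "iid_increments \<nu>"
      by (simp add: ergodic_central_def, rule ergodic_central_imp_iid)
  next
    fix \<nu> assume "central gen \<nu> \<and> iid_increments \<nu>"
    then show "ergodic_central gen \<nu>"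
      by (auto simp: iid_increments_def intro: iid_imp_ergodic_central)
  qed
  \<comment> \<open>By uniqueness a central measure with i.i.d. increments is
    \<open>iid_measure\<close> of its law, so the image is the whole set just identified with the
    absolute.\<close>
  have "iid_measure ` {\<mu>. central gen (iid_measure \<mu>)} = {\<nu>. central gen \<nu> \<and> iid_increments \<nu>}"
  proof (intro set_eqI iffI)
    fix \<nu> assume "\<nu> \<in> iid_measure ` {\<mu>. central gen (iid_measure \<mu>)}"
    then show "\<nu> \<in> {\<nu>. central gen \<nu> \<and> iid_increments \<nu>}"
      using iid_increments_law_iid_measure by (auto simp: iid_increments_def)
  next
    fix \<nu> assume "\<nu> \<in> {\<nu>. central gen \<nu> \<and> iid_increments \<nu>}"
    then obtain \<mu> where \<nu>: "central gen \<nu>" and "iid_increments_law \<mu> \<nu>"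
      by (auto simp: iid_increments_def)
    then have "\<nu> = iid_measure \<mu>"
      by (intro iid_increments_law_unique path_measure_central)
    with \<nu> show "\<nu> \<in> iid_measure ` {\<mu>. central gen (iid_measure \<mu>)}"
      by blast
  qed
  moreover have "inj_on iid_measure {\<mu>. central gen (iid_measure \<mu>)}"
    by (rule inj_on_subset [OF inj_iid_measure]) simp
  ultimately show "bij_betw iid_measure {\<mu>. central gen (iid_measure \<mu>)} (absolute gen)"
    by (simp add: bij_betw_def abs)
qed

end
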